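(* Let $\mathbf{k}$ be a commutative ring with unit. The infinitesimal coproduct $\Delta_{\rm LR}^{\epsilon}:H_{\rm LR}^{\epsilon}\to H_{\rm LR}^{\epsilon}\otimes H_{\rm LR}^{\epsilon}$ on planar binary trees is coassociative: $$(\Delta_{\rm LR}^{\epsilon}\otimes\mathrm{id})\Delta_{\rm LR}^{\epsilon}=(\mathrm{id}\otimes\Delta_{\rm LR}^{\epsilon})\Delta_{\rm LR}^{\epsilon}.$$
   Context: All modules, tensor products and linear maps are over $\mathbf{k}$. Planar binary trees: a planar binary tree is a finite rooted planar tree in which every internal vertex has exactly two ordered incoming branches (left and right). The trivial tree, with no internal vertices, is denoted $|$. Let $\mathcal{Y}$ be the set of planar binary trees and $H_{\rm LR}^{\epsilon}:=\mathbf{k}\mathcal{Y}$ the free $\mathbf{k}$-module on it. Grafting: for $T_l,T_r\in\mathcal{Y}$, $T_l\vee T_r$ is the tree obtained by creating a new root with left branch $T_l$ and right branch $T_r$; $\vee$ is extended bilinearly. Every $T\in\mathcal{Y}$ with $T\neq |$ is uniquely of the form $T=T_l\vee T_r$. Infinitesimal coproduct: the linear map $\Delta_{\rm LR}^{\epsilon}$ is defined on trees recursively by $\Delta_{\rm LR}^{\epsilon}(|)=0$ and $$\Delta_{\rm LR}^{\epsilon}(T_l\vee T_r)=T_l\otimes T_r+(\mathrm{id}\otimes\vee)(\Delta_{\rm LR}^{\epsilon}(T_l)\otimes T_r)+(\vee\otimes\mathrm{id})(T_l\otimes\Delta_{\rm LR}^{\epsilon}(T_r)).$$ *)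

theory Defs
  imports Complex_Main "HOL-Library.Poly_Mapping"
begin

text \<open>
  The sort \<open>{comm_ring, comm_monoid_mult}\<close> is that of arbitrary commutative unital rings; the library
  class \<open>comm_ring_1\<close> additionally demands \<open>0 \<noteq> 1\<close>, which is not assumed here.

  The free module on \<open>'a\<close> is \<open>'a \<Rightarrow>\<^sub>0 'k\<close>, the finitely supported functions. The library's
  multiplication on this type is a convolution and plays no role.
\<close>

definition smult :: "'k::{comm_ring,comm_monoid_mult} \<Rightarrow> ('a \<Rightarrow>\<^sub>0 'k) \<Rightarrow> ('a \<Rightarrow>\<^sub>0 'k)" where
  "smult c x = Poly_Mapping.map ((*) c) x"

definition basis :: "'a \<Rightarrow> ('a \<Rightarrow>\<^sub>0 'k::{comm_ring,comm_monoid_mult})" where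
  "basis a = Poly_Mapping.single a 1"

definition lin_ext ::
  "('a \<Rightarrow> ('b \<Rightarrow>\<^sub>0 'k)) \<Rightarrow> ('a \<Rightarrow>\<^sub>0 'k::{comm_ring,comm_monoid_mult}) \<Rightarrow> ('b \<Rightarrow>\<^sub>0 'k)" where
  "lin_ext f x = (\<Sum>a\<in>Poly_Mapping.keys x. smult (Poly_Mapping.lookup x a) (f a))"

text \<open>
  The tensor product of the free modules on \<open>'a\<close> and \<open>'b\<close> is realised as the free module on
  \<open>'a \<times> 'b\<close>, with \<open>basis a \<otimes> basis b\<close> corresponding to the basis element \<open>(a, b)\<close>.
  The lemma \<open>tensor_universal\<close> below shows that this has the universal property of the tensor product.
\<close>

definition tensor :: "('a \<Rightarrow>\<^sub>0 'k) \<Rightarrow> ('b \<Rightarrow>\<^sub>0 'k) \<Rightarrow> ('a \<times> 'b \<Rightarrow>\<^sub>0 'k::{comm_ring,comm_monoid_mult})"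
    (infixr "\<otimes>" 75) where
  "x \<otimes> y = lin_ext (\<lambda>a. lin_ext (\<lambda>b. basis (a, b)) y) x"

text \<open>
  The tensor product of two linear maps, and the canonical identification of
  \<open>(U \<otimes> V) \<otimes> W\<close> with \<open>U \<otimes> (V \<otimes> W)\<close>, which are different types here.
\<close>

definition tensor_map ::
  "(('a \<Rightarrow>\<^sub>0 'k) \<Rightarrow> ('c \<Rightarrow>\<^sub>0 'k)) \<Rightarrow> (('b \<Rightarrow>\<^sub>0 'k) \<Rightarrow> ('d \<Rightarrow>\<^sub>0 'k)) \<Rightarrow>
   ('a \<times> 'b \<Rightarrow>\<^sub>0 'k) \<Rightarrow> ('c \<times> 'd \<Rightarrow>\<^sub>0 'k::{comm_ring,comm_monoid_mult})" (infixr "\<otimes>\<^sub>m" 75) where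
  "f \<otimes>\<^sub>m g = lin_ext (\<lambda>(a, b). f (basis a) \<otimes> g (basis b))"

definition assoc ::
  "(('a \<times> 'b) \<times> 'c \<Rightarrow>\<^sub>0 'k) \<Rightarrow> ('a \<times> ('b \<times> 'c) \<Rightarrow>\<^sub>0 'k::{comm_ring,comm_monoid_mult})" where
  "assoc = lin_ext (\<lambda>((a, b), c). basis a \<otimes> (basis b \<otimes> basis c))"

definition assoc_inv ::
  "('a \<times> ('b \<times> 'c) \<Rightarrow>\<^sub>0 'k) \<Rightarrow> (('a \<times> 'b) \<times> 'c \<Rightarrow>\<^sub>0 'k::{comm_ring,comm_monoid_mult})" where
  "assoc_inv = lin_ext (\<lambda>(a, (b, c)). (basis a \<otimes> basis b) \<otimes> basis c)"

datatype ptree = Trivial | Graft ptree ptree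

definition graft :: "(ptree \<times> ptree \<Rightarrow>\<^sub>0 'k) \<Rightarrow> (ptree \<Rightarrow>\<^sub>0 'k::{comm_ring,comm_monoid_mult})" where
  "graft = lin_ext (\<lambda>(l, r). basis (Graft l r))"

primrec coprod_tree :: "ptree \<Rightarrow> (ptree \<times> ptree \<Rightarrow>\<^sub>0 'k::{comm_ring,comm_monoid_mult})" where
  "coprod_tree Trivial = 0"
| "coprod_tree (Graft l r) =
     basis l \<otimes> basis r
     + (id \<otimes>\<^sub>m graft) (assoc (coprod_tree l \<otimes> basis r))
     + (graft \<otimes>\<^sub>m id) (assoc_inv (basis l \<otimes> coprod_tree r))"

definition coprod ::
  "(ptree \<Rightarrow>\<^sub>0 'k) \<Rightarrow> (ptree \<times> ptree \<Rightarrow>\<^sub>0 'k::{comm_ring,comm_monoid_mult})" where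
  "coprod = lin_ext coprod_tree"

subsection \<open>Adequacy of the definitions\<close>

definition is_linear :: "(('a \<Rightarrow>\<^sub>0 'k) \<Rightarrow> ('b \<Rightarrow>\<^sub>0 'k::{comm_ring,comm_monoid_mult})) \<Rightarrow> bool" where
  "is_linear f \<longleftrightarrow> (\<forall>x y. f (x + y) = f x + f y) \<and> (\<forall>c x. f (smult c x) = smult c (f x))"

lemma lookup_smult [simp]: "Poly_Mapping.lookup (smult c x) a = c * Poly_Mapping.lookup x a"
  by (simp add: smult_def Poly_Mapping.map.rep_eq when_def)

lemma smult_simps [simp]:
  "smult c (x + y) = smult c x + smult c y" "smult (c + d) x = smult c x + smult d x"
  "smult c (smult d x) = smult (c * d) x" "smult 1 x = x" "smult 0 x = 0" "smult c 0 = 0"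
  by (auto intro!: poly_mapping_eqI simp: lookup_add algebra_simps)

lemma smult_sum: "smult c (sum f A) = (\<Sum>a\<in>A. smult c (f a))"
  by (induction A rule: infinite_finite_induct) auto

lemma lin_ext_superset:
  assumes "finite A" "Poly_Mapping.keys x \<subseteq> A"
  shows "lin_ext f x = (\<Sum>a\<in>A. smult (Poly_Mapping.lookup x a) (f a))"
  unfolding lin_ext_def
  by (rule sum.mono_neutral_left) (use assms in \<open>auto simp: in_keys_iff\<close>)

lemma lin_ext_basis [simp]: "lin_ext f (basis a) = f a"
  by (subst lin_ext_superset[where A = "{a}"]) (auto simp: basis_def lookup_single when_def)

lemma is_linear_lin_ext: "is_linear (lin_ext f)"
proof -
  have "lin_ext f (x + y) = lin_ext f x + lin_ext f y" for x y
  proof -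
    let ?A = "Poly_Mapping.keys x \<union> Poly_Mapping.keys y"
    have "Poly_Mapping.keys (x + y) \<subseteq> ?A" by (rule Poly_Mapping.keys_add)
    then show ?thesis
      by (simp add: lin_ext_superset[where A = ?A] lookup_add sum.distrib)
  qed
  moreover have "lin_ext f (smult c x) = smult c (lin_ext f x)" for c x
  proof -
    have "Poly_Mapping.keys (smult c x) \<subseteq> Poly_Mapping.keys x"
      by (auto simp: in_keys_iff)
    then show ?thesis
      by (simp add: lin_ext_superset[where A = "Poly_Mapping.keys x"] smult_sum)
  qed
  ultimately show ?thesis by (simp add: is_linear_def)
qed

lemma basis_expansion: "x = (\<Sum>a\<in>Poly_Mapping.keys x. smult (Poly_Mapping.lookup x a) (basis a))"
  by (rule poly_mapping_eqI)
    (auto simp: lookup_sum basis_def lookup_single when_def if_distrib[of "(*) _"] in_keys_iff cong: if_cong)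

lemma lookup_tensor [simp]:
  "Poly_Mapping.lookup (x \<otimes> y) (a, b) = Poly_Mapping.lookup x a * Poly_Mapping.lookup y b"
proof -
  have "Poly_Mapping.lookup (lin_ext (\<lambda>b. basis (a', b)) y) (a, b)
      = (if a' = a then Poly_Mapping.lookup y b else 0)" for a'
    by (auto simp: lin_ext_def lookup_sum basis_def lookup_single when_def
        if_distrib[of "(*) _"] in_keys_iff cong: if_cong)
  then show ?thesis
    by (auto simp: tensor_def lin_ext_def[of _ x] lookup_sum
        if_distrib[of "(*) _"] in_keys_iff cong: if_cong)
qed

lemma tensor_bilinear: "is_linear (\<lambda>x. x \<otimes> y)" "is_linear (\<lambda>y. x \<otimes> y)"
  by (auto simp: is_linear_def lookup_add algebra_simps intro!: poly_mapping_eqI)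

lemma tensor_basis: "basis a \<otimes> basis b = basis (a, b)"
  by (simp add: tensor_def)

lemma is_linear_sum:
  assumes "is_linear f"
  shows "f (sum h A) = (\<Sum>a\<in>A. f (h a))"
proof -
  have "f 0 = 0"
    using assms unfolding is_linear_def by (metis smult_simps(5))
  then show ?thesis
    using assms by (induction A rule: infinite_finite_induct) (auto simp: is_linear_def)
qed

lemma is_linear_eqI:
  assumes "is_linear f" "is_linear g" "\<And>a. f (basis a) = g (basis a)"
  shows "f x = g x"
  using assms
  by (subst (1 2) basis_expansion[of x]) (simp add: is_linear_sum, simp add: is_linear_def)

lemma is_linear_comp: "is_linear f \<Longrightarrow> is_linear g \<Longrightarrow> is_linear (\<lambda>x. f (g x))"
  by (simp add: is_linear_def)

lemma is_linear_tensor_map [simp]: "is_linear (f \<otimes>\<^sub>m g)"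
  and is_linear_assoc [simp]: "is_linear assoc"
  and is_linear_assoc_inv [simp]: "is_linear assoc_inv"
  and is_linear_graft: "is_linear graft"
  and is_linear_coprod: "is_linear coprod"
  by (simp_all add: tensor_map_def assoc_def assoc_inv_def graft_def coprod_def is_linear_lin_ext)

lemma tensor_map_tensor:
  assumes "is_linear f" "is_linear g"
  shows "(f \<otimes>\<^sub>m g) (x \<otimes> y) = f x \<otimes> g y"
proof (rule is_linear_eqI[where f = "\<lambda>x. (f \<otimes>\<^sub>m g) (x \<otimes> y)"])
  fix a
  show "(f \<otimes>\<^sub>m g) (basis a \<otimes> y) = f (basis a) \<otimes> g y"
    by (rule is_linear_eqI[where f = "\<lambda>y. (f \<otimes>\<^sub>m g) (basis a \<otimes> y)"])
      (auto intro: is_linear_comp tensor_bilinear is_linear_comp[OF tensor_bilinear(2)] assms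
        simp: tensor_basis, simp add: tensor_map_def)
qed (auto intro: is_linear_comp tensor_bilinear is_linear_comp[OF tensor_bilinear(1)] assms)

lemma assoc_basis [simp]: "assoc (basis ((a, b), c)) = basis (a, (b, c))"
  and assoc_inv_basis [simp]: "assoc_inv (basis (a, (b, c))) = basis ((a, b), c)"
  by (simp_all add: assoc_def assoc_inv_def tensor_basis)

lemma assoc_assoc_inv: "assoc (assoc_inv x) = x" and assoc_inv_assoc: "assoc_inv (assoc y) = y"
proof -
  have id: "is_linear (\<lambda>x. x)" by (simp add: is_linear_def)
  show "assoc (assoc_inv x) = x"
    by (rule is_linear_eqI[OF is_linear_comp id]) auto
  show "assoc_inv (assoc y) = y"
    by (rule is_linear_eqI[OF is_linear_comp id]) auto
qed

lemma lookup_assoc: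
  "Poly_Mapping.lookup (assoc x) (a, (b, c)) = Poly_Mapping.lookup x ((a, b), c)"
  by (subst (2) basis_expansion[of x])
    (auto simp: assoc_def lin_ext_def lookup_sum tensor_basis basis_def lookup_single when_def
      intro!: sum.cong)

lemma assoc_tensor: "assoc ((x \<otimes> y) \<otimes> z) = x \<otimes> (y \<otimes> z)"
  by (rule poly_mapping_eqI) (auto simp: lookup_assoc mult.assoc)

lemma assoc_inv_tensor: "assoc_inv (x \<otimes> (y \<otimes> z)) = (x \<otimes> y) \<otimes> z"
  by (metis assoc_tensor assoc_inv_assoc)

text \<open>\<open>module_hom\<close> restricts the next lemma to nonzero rings; over the zero ring all modules are zero.\<close>

lemma tensor_universal:
  fixes scale :: "'k::comm_ring_1 \<Rightarrow> 'm::ab_group_add \<Rightarrow> 'm"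
    and B :: "('a \<Rightarrow>\<^sub>0 'k) \<Rightarrow> ('b \<Rightarrow>\<^sub>0 'k) \<Rightarrow> 'm"
  assumes 1: "\<And>y. module_hom smult scale (\<lambda>x. B x y)" and 2: "\<And>x. module_hom smult scale (B x)"
  shows "\<exists>!L. module_hom smult scale L \<and> (\<forall>x y. L (x \<otimes> y) = B x y)"
proof -
  interpret M: module scale
    using 1[of 0] by (simp add: module_hom_def)
  have expand: "f x = (\<Sum>a\<in>Poly_Mapping.keys x. scale (Poly_Mapping.lookup x a) (f (basis a)))"
    if "module_hom smult scale f" for f :: "('c \<Rightarrow>\<^sub>0 'k) \<Rightarrow> 'm" and x
  proof -
    interpret module_hom smult scale f by (fact that)
    show ?thesis by (subst basis_expansion[of x]) (simp add: sum scale)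
  qed
  define L where "L = (\<lambda>w :: 'a \<times> 'b \<Rightarrow>\<^sub>0 'k. \<Sum>p\<in>Poly_Mapping.keys w.
     scale (Poly_Mapping.lookup w p) (B (basis (fst p)) (basis (snd p))))"
  have L_sup: "L w = (\<Sum>p\<in>A. scale (Poly_Mapping.lookup w p) (B (basis (fst p)) (basis (snd p))))"
    if "finite A" "Poly_Mapping.keys w \<subseteq> A" for w A
    unfolding L_def by (rule sum.mono_neutral_left) (use that in \<open>auto simp: in_keys_iff\<close>)
  have hom: "module_hom smult scale L"
  proof (unfold_locales)
    fix v w :: "'a \<times> 'b \<Rightarrow>\<^sub>0 'k" and c
    let ?A = "Poly_Mapping.keys v \<union> Poly_Mapping.keys w"
    show "L (v + w) = L v + L w"
      using Poly_Mapping.keys_add[of v w]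
      by (simp add: L_sup[of ?A] lookup_add M.scale_left_distrib sum.distrib)
    show "L (smult c v) = scale c (L v)"
      by (subst L_sup[of "Poly_Mapping.keys v"])
        (auto simp: L_def in_keys_iff M.scale_sum_right)
  qed (auto)
  have LB: "L (x \<otimes> y) = B x y" for x y
  proof -
    have "Poly_Mapping.keys (x \<otimes> y) \<subseteq> Poly_Mapping.keys x \<times> Poly_Mapping.keys y"
      by (auto simp: in_keys_iff)
    then have "L (x \<otimes> y) = (\<Sum>p\<in>Poly_Mapping.keys x \<times> Poly_Mapping.keys y.
        scale (Poly_Mapping.lookup (x \<otimes> y) p) (B (basis (fst p)) (basis (snd p))))"
      by (intro L_sup) auto
    also have "\<dots> = (\<Sum>a\<in>Poly_Mapping.keys x. scale (Poly_Mapping.lookup x a)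
        (\<Sum>b\<in>Poly_Mapping.keys y. scale (Poly_Mapping.lookup y b) (B (basis a) (basis b))))"
      by (simp add: sum.cartesian_product' M.scale_sum_right)
    also have "\<dots> = B x y"
      by (simp add: expand[OF 2, symmetric] expand[OF 1, symmetric])
    finally show ?thesis .
  qed
  show ?thesis
  proof (rule ex1I[of _ L])
    fix L' assume L': "module_hom smult scale L' \<and> (\<forall>x y. L' (x \<otimes> y) = B x y)"
    then have "L' (basis p) = L (basis p)" for p
      using LB by (metis tensor_basis surj_pair)
    then have "L' w = L w" for w
      using expand[of L' w] expand[OF hom, of w] L' by simp
    then show "L' = L" by auto
  qed (use hom LB in auto)
qed

lemma coprod_Trivial: "coprod (basis Trivial) = 0"
  and coprod_Graft: "coprod (graft (basis l \<otimes> basis r)) =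
    basis l \<otimes> basis r
    + (id \<otimes>\<^sub>m graft) (assoc (coprod (basis l) \<otimes> basis r))
    + (graft \<otimes>\<^sub>m id) (assoc_inv (basis l \<otimes> coprod (basis r)))"
  by (simp_all add: coprod_def graft_def tensor_basis)

end

theory Submission
  imports Defs
begin

text \<open>
  Unfolding the recursion shows that \<open>\<Delta>(T)\<close> has one term for each way of cutting \<open>T\<close> in two along
  the path from the root to one of the gaps between neighbouring leaves: the left factor is what
  remains on the left of the path, the right factor what remains on its right (vertices left with
  a single branch being contracted). Iterating the coproduct on either side yields the cuts of \<open>T\<close>
  in three along two distinct gaps, and it does not matter which of the two gaps is used first.

  Linear maps between free modules are determined by their values on basis elements, so it suffices
  to sum an arbitrary function \<open>f\<close> of the two parts over all cuts of a tree; this is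
  \<open>cut_sum f T\<close>. The lemma \<open>linear_coprod_tree\<close> says that every linear map sends \<open>\<Delta>(T)\<close> to
  such a sum, and \<open>cut_sum_coassoc\<close> is the equality of the two iterated sums, valid in any
  commutative monoid. For \<open>T = l \<or> r\<close> its five kinds of terms, with the pair of gaps lying within
  \<open>l\<close>, within \<open>r\<close>, in \<open>l\<close> and the middle, in the middle and \<open>r\<close>, or one in each of \<open>l\<close> and \<open>r\<close>,
  match one by one. Pairs within \<open>l\<close> or within \<open>r\<close> are covered by induction, and the last kind
  gives \<open>l\<^sub>1 \<otimes> (l\<^sub>2 \<or> r\<^sub>1) \<otimes> r\<^sub>2\<close> on both sides, up to the order of summation over the cuts
  \<open>(l\<^sub>1, l\<^sub>2)\<close> of \<open>l\<close> and \<open>(r\<^sub>1, r\<^sub>2)\<close> of \<open>r\<close>.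
\<close>

fun cut_sum :: "(ptree \<Rightarrow> ptree \<Rightarrow> 'm::comm_monoid_add) \<Rightarrow> ptree \<Rightarrow> 'm" where
  "cut_sum f Trivial = 0"
| "cut_sum f (Graft l r) =
     f l r + cut_sum (\<lambda>a b. f a (Graft b r)) l + cut_sum (\<lambda>a b. f (Graft l a) b) r"

lemma cut_sum_zero [simp]: "cut_sum (\<lambda>a b. 0) T = 0"
  by (induction T) simp_all

lemma cut_sum_add: "cut_sum (\<lambda>a b. f a b + g a b) T = cut_sum f T + cut_sum g T"
  by (induction T arbitrary: f g) (simp_all add: ac_simps)

lemma cut_sum_swap:
  "cut_sum (\<lambda>a b. cut_sum (\<lambda>c d. f a b c d) S) T = cut_sum (\<lambda>c d. cut_sum (\<lambda>a b. f a b c d) T) S"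
  by (induction T arbitrary: f) (simp_all add: cut_sum_add)

text \<open>
  Both sides sum \<open>f\<close> over the cuts of \<open>T\<close> in three; the left one cuts at the right-hand gap first,
  the right one at the left-hand gap.
\<close>
lemma cut_sum_coassoc:
  "cut_sum (\<lambda>p c. cut_sum (\<lambda>a b. f a b c) p) T = cut_sum (\<lambda>a q. cut_sum (\<lambda>b c. f a b c) q) T"
proof (induction T arbitrary: f)
  case (Graft l r)
  \<comment> \<open>One gap in each branch: the middle part is grafted from the inner parts of both.\<close>
  have "cut_sum (\<lambda>r\<^sub>1 r\<^sub>2. cut_sum (\<lambda>l\<^sub>1 l\<^sub>2. f l\<^sub>1 (Graft l\<^sub>2 r\<^sub>1) r\<^sub>2) l) r
      = cut_sum (\<lambda>l\<^sub>1 l\<^sub>2. cut_sum (\<lambda>r\<^sub>1 r\<^sub>2. f l\<^sub>1 (Graft l\<^sub>2 r\<^sub>1) r\<^sub>2) r) l"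
    by (rule cut_sum_swap)
  then show ?case
    using Graft.IH(1)[of "\<lambda>a b c. f a b (Graft c r)"] Graft.IH(2)[of "\<lambda>a b c. f (Graft l a) b c"]
    by (simp add: cut_sum_add ac_simps)
qed simp

text \<open>
  The induction runs over all linear maps at once: in the recursive terms of the coproduct, \<open>L\<close> is
  composed with grafting onto one factor, and this composite is again linear in the coproduct of
  the branch.
\<close>
lemma linear_coprod_tree:
  fixes L :: "(ptree \<times> ptree \<Rightarrow>\<^sub>0 'k::{comm_ring,comm_monoid_mult}) \<Rightarrow> ('b \<Rightarrow>\<^sub>0 'k)"
  assumes "is_linear L"
  shows "L (coprod_tree T) = cut_sum (\<lambda>a b. L (basis (a, b))) T"
  using assms
proof (induction T arbitrary: L)
  case Trivial
  then show ?case
    using is_linear_sum[of L _ "{}"] by simp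
next
  case (Graft l r)
  let ?Ll = "\<lambda>x. L ((id \<otimes>\<^sub>m graft) (assoc (x \<otimes> basis r)))"
  let ?Lr = "\<lambda>x. L ((graft \<otimes>\<^sub>m id) (assoc_inv (basis l \<otimes> x)))"
  have "is_linear ?Ll" "is_linear ?Lr"
    using Graft.prems is_linear_comp[OF _ is_linear_comp[OF is_linear_tensor_map
        is_linear_comp[OF is_linear_assoc tensor_bilinear(1)]]]
      is_linear_comp[OF _ is_linear_comp[OF is_linear_tensor_map
        is_linear_comp[OF is_linear_assoc_inv tensor_bilinear(2)]]]
    by blast+
  moreover have "?Ll (basis (a, b)) = L (basis (a, Graft b r))"
    and "?Lr (basis (a, b)) = L (basis (Graft l a, b))" for a b
    by (simp_all add: tensor_basis tensor_map_def graft_def)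
  ultimately have "?Ll (coprod_tree l) = cut_sum (\<lambda>a b. L (basis (a, Graft b r))) l"
    and "?Lr (coprod_tree r) = cut_sum (\<lambda>a b. L (basis (Graft l a, b))) r"
    using Graft.IH(1)[of ?Ll] Graft.IH(2)[of ?Lr] by simp_all
  then show ?case
    using Graft.prems by (simp add: is_linear_def tensor_basis)
qed

theorem proposition2p4:
  "assoc \<circ> (coprod \<otimes>\<^sub>m id) \<circ> coprod
   = (id \<otimes>\<^sub>m coprod) \<circ> (coprod :: (ptree \<Rightarrow>\<^sub>0 'k::{comm_ring,comm_monoid_mult}) \<Rightarrow> _)"
proof (rule ext)
  fix x :: "ptree \<Rightarrow>\<^sub>0 'k"
  let ?lhs = "\<lambda>x :: ptree \<times> ptree \<Rightarrow>\<^sub>0 'k. assoc ((coprod \<otimes>\<^sub>m id) x)"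
  let ?rhs = "id \<otimes>\<^sub>m coprod :: (ptree \<times> ptree \<Rightarrow>\<^sub>0 'k) \<Rightarrow> _"
  have lin: "is_linear ?lhs" "is_linear ?rhs"
    using is_linear_comp[OF is_linear_assoc is_linear_tensor_map] is_linear_tensor_map by blast+
  then have lin_coprod: "is_linear (\<lambda>x. ?lhs (coprod x))" "is_linear (\<lambda>x. ?rhs (coprod x))"
    using is_linear_comp[OF _ is_linear_coprod] by blast+
  have lhs: "?lhs (basis (p, c)) = cut_sum (\<lambda>a b. basis (a, (b, c))) p" for p c
  proof -
    have "is_linear (\<lambda>x :: ptree \<times> ptree \<Rightarrow>\<^sub>0 'k. assoc (x \<otimes> basis c))"
      by (rule is_linear_comp[OF is_linear_assoc tensor_bilinear(1)])
    from linear_coprod_tree[OF this, of p] show ?thesis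
      by (simp add: tensor_map_def coprod_def tensor_basis)
  qed
  have rhs: "?rhs (basis (a, q)) = cut_sum (\<lambda>b c. basis (a, (b, c))) q" for a q
    using linear_coprod_tree[OF tensor_bilinear(2)[of "basis a"], of q]
    by (simp add: tensor_map_def coprod_def tensor_basis)
  have coprod_basis: "coprod (basis T) = (coprod_tree T :: _ \<Rightarrow>\<^sub>0 'k)" for T
    by (simp add: coprod_def)
  have "?lhs (coprod (basis T)) = ?rhs (coprod (basis T))" for T
  proof -
    have "?lhs (coprod (basis T)) = cut_sum (\<lambda>p c. cut_sum (\<lambda>a b. basis (a, (b, c))) p) T"
      by (simp add: coprod_basis linear_coprod_tree[OF lin(1)] lhs)
    also have "\<dots> = cut_sum (\<lambda>a q. cut_sum (\<lambda>b c. basis (a, (b, c))) q) T"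
      by (rule cut_sum_coassoc)
    also have "\<dots> = ?rhs (coprod (basis T))"
      by (simp add: coprod_basis linear_coprod_tree[OF lin(2)] rhs)
    finally show ?thesis .
  qed
  then show "(assoc \<circ> (coprod \<otimes>\<^sub>m id) \<circ> coprod) x = ((id \<otimes>\<^sub>m coprod) \<circ> coprod) x"
    using is_linear_eqI[OF lin_coprod] by simp
qed

end
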